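(* Let $d\in\mathbb N$, $d\ge 2$. Let $a_i,b_i\in[0,1]$, $i=1,\ldots,d$. For $\mathbb I\in\{0,1,2\}^d$ let $x_{\mathbb I}\in\prod_{i=1}^d\{a_i,b_i,1\}$ be the point with $k$-th coordinate $(x_{\mathbb I})_k=a_k$ if $\mathbb I_k=0$, $(x_{\mathbb I})_k=b_k$ if $\mathbb I_k=1$, and $(x_{\mathbb I})_k=1$ if $\mathbb I_k=2$. Let $q_{\mathbb I}\in[0,1]$, $\mathbb I\in\{0,1,2\}^d$, be real numbers. Suppose that $$a_\ell<b_\ell\quad\text{for }\ell=1,\ldots,d,$$ $$0\le q_{\mathbb J}-q_{\mathbb I}\le b_\ell-a_\ell\quad\text{for all }\ell=1,\ldots,d\text{ and all }\mathbb I\sim_\ell\mathbb J\text{ in }\{0,1,2\}^d\text{ with }\mathbb J_\ell=1,$$ $$0\le q_{\mathbb J}-q_{\mathbb I}\le 1-b_\ell\quad\text{for all }\ell=1,\ldots,d\text{ and all }\mathbb I\sim_\ell\mathbb J\text{ in }\{0,1,2\}^d\text{ with }\mathbb J_\ell=2,$$ $$G_d(x_{\mathbb I})\le q_{\mathbb I}\le H_d(x_{\mathbb I})\quad\text{for all }\mathbb I\in\{0,1,2\}^d.$$ Then there exists a $d$-quasi-copula $Q:[0,1]^d\to[0,1]$ such that $Q(x_{\mathbb I})=q_{\mathbb I}$ for all $\mathbb I\in\{0,1,2\}^d$.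
   Context: A $d$-quasi-copula is a function $Q:[0,1]^d\to[0,1]$ such that: (BC) $Q(u_1,\ldots,u_d)=0$ whenever some $u_i=0$, and $Q(1,\ldots,1,u_i,1,\ldots,1)=u_i$ for every $i$ and every $u_i\in[0,1]$; (MC) $Q$ is nondecreasing in each variable; (LC) $|Q(u_1,\ldots,u_d)-Q(v_1,\ldots,v_d)|\le\sum_{i=1}^d|u_i-v_i|$ for all points of $[0,1]^d$. For multi-indices $\mathbb I,\mathbb J$ write $\mathbb I\sim_\ell\mathbb J$ if $\mathbb J-\mathbb I=\mathbb E^{(\ell)}$, where $\mathbb E^{(\ell)}$ is the multi-index whose only non-zero coordinate is the $\ell$-th one, equal to $1$. For $x=(x_1,\ldots,x_d)\in\mathbb R^d$: $G_d(x)=\sum_{i=1}^dx_i-d+1$ and $H_d(x)=\min\{x_1,\ldots,x_d\}$. *)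

theory Defs
  imports "HOL-Analysis.Analysis"
begin

text \<open>Points of \<open>d\<close>-dimensional space are vectors \<open>real ^ 'n\<close>, so that \<open>d = CARD('n)\<close>.
  Functions on the unit cube are total functions of which only the values on the cube matter.\<close>

definition unit_cube :: "(real ^ 'n) set"
  where "unit_cube = {u. \<forall>i. 0 \<le> u $ i \<and> u $ i \<le> 1}"

definition vec_upd :: "'a ^ 'n \<Rightarrow> 'n \<Rightarrow> 'a \<Rightarrow> 'a ^ 'n"
  where "vec_upd u i t = (\<chi> k. if k = i then t else u $ k)"

definition boundary_condition :: "(real ^ 'n \<Rightarrow> real) \<Rightarrow> bool"
  where "boundary_condition Q \<longleftrightarrow>
    (\<forall>u \<in> unit_cube. (\<exists>i. u $ i = 0) \<longrightarrow> Q u = 0) \<and>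
    (\<forall>i. \<forall>t \<in> {0..1}. Q (vec_upd (\<chi> k. 1) i t) = t)"

definition monotonicity_condition :: "(real ^ 'n \<Rightarrow> real) \<Rightarrow> bool"
  where "monotonicity_condition Q \<longleftrightarrow>
    (\<forall>u \<in> unit_cube. \<forall>i. \<forall>s \<in> {0..1}. \<forall>t \<in> {0..1}.
       s \<le> t \<longrightarrow> Q (vec_upd u i s) \<le> Q (vec_upd u i t))"

definition lipschitz_condition :: "(real ^ 'n \<Rightarrow> real) \<Rightarrow> bool"
  where "lipschitz_condition Q \<longleftrightarrow>
    (\<forall>u \<in> unit_cube. \<forall>v \<in> unit_cube. \<bar>Q u - Q v\<bar> \<le> (\<Sum>i\<in>UNIV. \<bar>u $ i - v $ i\<bar>))"

definition quasi_copula :: "(real ^ 'n \<Rightarrow> real) \<Rightarrow> bool"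
  where "quasi_copula Q \<longleftrightarrow>
    Q \<in> unit_cube \<rightarrow> {0..1} \<and>
    boundary_condition Q \<and> monotonicity_condition Q \<and> lipschitz_condition Q"

text \<open>Multi-indices have integer entries, so that their difference is not truncated.\<close>

definition multi_indices :: "(int ^ 'n) set"
  where "multi_indices = {I. \<forall>k. I $ k \<in> {0, 1, 2}}"

definition adjacent :: "'n \<Rightarrow> int ^ 'n \<Rightarrow> int ^ 'n \<Rightarrow> bool"
  where "adjacent l I J \<longleftrightarrow> J - I = axis l 1"

definition grid_point :: "real ^ 'n \<Rightarrow> real ^ 'n \<Rightarrow> int ^ 'n \<Rightarrow> real ^ 'n"
  where "grid_point a b I =
    (\<chi> k. if I $ k = 0 then a $ k else if I $ k = 1 then b $ k else 1)"

definition G :: "real ^ 'n \<Rightarrow> real"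
  where "G x = (\<Sum>i\<in>UNIV. x $ i) - real CARD('n) + 1"

definition H :: "real ^ 'n \<Rightarrow> real"
  where "H x = Min (range (\<lambda>i. x $ i))"

end

theory Submission
  imports Defs
begin

text \<open>A function on the cube is increasing and 1-Lipschitz for the \<open>\<ell>\<^sub>1\<close> norm if and only if
  \<open>Q u - Q v \<le> \<Sum>i. (u\<^sub>i - v\<^sub>i)\<^sup>+\<close>, that is, if it is 1-Lipschitz for an asymmetric distance. Data with
  this property extend by McShane's formula \<open>u \<mapsto> INF I. q\<^sub>I + \<Sum>i. (u\<^sub>i - (x\<^sub>I)\<^sub>i)\<^sup>+\<close>. Taking the minimum
  with \<open>H\<close> enforces the upper bound demanded by the boundary condition; the lower bound \<open>G\<close> is
  inherited from \<open>G (x\<^sub>I) \<le> q\<^sub>I\<close>, and \<open>G = H\<close> on the edges of the cube through \<open>(1,\<dots>,1)\<close>.\<close>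

definition pos_dist :: "real ^ 'n \<Rightarrow> real ^ 'n \<Rightarrow> real"
  where "pos_dist u v = (\<Sum>i\<in>UNIV. max 0 (u $ i - v $ i))"

lemma pos_dist_nonneg: "0 \<le> pos_dist u v"
  unfolding pos_dist_def by (intro sum_nonneg) simp

lemma pos_dist_self [simp]: "pos_dist u u = 0"
  by (simp add: pos_dist_def)

lemma pos_dist_triangle: "pos_dist u w \<le> pos_dist u v + pos_dist v w"
  unfolding pos_dist_def sum.distrib[symmetric] by (intro sum_mono) linarith

lemma pos_dist_eq_0: "pos_dist u v = 0" if "\<And>i. u $ i \<le> v $ i"
  unfolding pos_dist_def using that by (intro sum.neutral) simp

lemma pos_dist_le_l1: "pos_dist u v \<le> (\<Sum>i\<in>UNIV. \<bar>u $ i - v $ i\<bar>)"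
  unfolding pos_dist_def by (intro sum_mono) linarith

lemma component_le_pos_dist: "u $ i \<le> v $ i + pos_dist u v"
proof -
  have "max 0 (u $ i - v $ i) \<le> pos_dist u v"
    unfolding pos_dist_def by (rule member_le_sum) auto
  then show ?thesis by linarith
qed

text \<open>Positive parts dominate the coordinate differences themselves. This carries the lower
  bound \<open>G\<close> from the data points to the rest of the cube.\<close>

lemma G_le_pos_dist: "G u \<le> G v + pos_dist u v"
proof -
  have "(\<Sum>i\<in>UNIV. u $ i - v $ i) \<le> pos_dist u v"
    unfolding pos_dist_def by (intro sum_mono) simp
  then show ?thesis by (simp add: G_def sum_subtractf)
qed

lemma H_le: "H u \<le> u $ i"
  by (simp add: H_def)

lemma le_H_iff: "c \<le> H u \<longleftrightarrow> (\<forall>i. c \<le> u $ i)"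
  by (simp add: H_def)

text \<open>Each coordinate obeys this asymmetric bound, and a minimum of such functions inherits
  it.\<close>

lemma H_le_pos_dist: "H u \<le> H v + pos_dist u v"
proof -
  have "H u - pos_dist u v \<le> H v"
    unfolding le_H_iff using H_le component_le_pos_dist by (smt (verit))
  then show ?thesis by simp
qed

lemma vec_upd_nth: "vec_upd u i t $ k = (if k = i then t else u $ k)"
  by (simp add: vec_upd_def)

lemma vec_upd_in_unit_cube:
  "u \<in> unit_cube \<Longrightarrow> t \<in> {0..1} \<Longrightarrow> vec_upd u i t \<in> unit_cube"
  by (simp add: unit_cube_def vec_upd_nth)

text \<open>Monotonicity holds because \<open>pos_dist u v\<close> vanishes when u lies below v; the
  Lipschitz bound follows by using the hypothesis in both directions.\<close>

lemma monotonicity_lipschitz_if_pos_dist: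
  assumes "\<And>u v. u \<in> unit_cube \<Longrightarrow> v \<in> unit_cube \<Longrightarrow> Q u \<le> Q v + pos_dist u v"
  shows "monotonicity_condition Q" and "lipschitz_condition Q"
proof -
  show "monotonicity_condition Q"
    unfolding monotonicity_condition_def
  proof (intro ballI allI impI)
    fix u :: "real ^ 'a" and i and s t :: real
    assume *: "u \<in> unit_cube" "s \<in> {0..1}" "t \<in> {0..1}" "s \<le> t"
    have "pos_dist (vec_upd u i s) (vec_upd u i t) = 0"
      using * by (intro pos_dist_eq_0) (simp add: vec_upd_nth)
    then show "Q (vec_upd u i s) \<le> Q (vec_upd u i t)"
      using assms[of "vec_upd u i s" "vec_upd u i t"] * by (simp add: vec_upd_in_unit_cube)
  qed
  show "lipschitz_condition Q"
    unfolding lipschitz_condition_def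
  proof (intro ballI)
    fix u v :: "real ^ 'a"
    assume "u \<in> unit_cube" "v \<in> unit_cube"
    then have "Q u \<le> Q v + pos_dist u v" "Q v \<le> Q u + pos_dist v u"
      using assms by blast+
    moreover have "(\<Sum>i\<in>UNIV. \<bar>v $ i - u $ i\<bar>) = (\<Sum>i\<in>UNIV. \<bar>u $ i - v $ i\<bar>)"
      by (simp add: abs_minus_commute)
    ultimately show "\<bar>Q u - Q v\<bar> \<le> (\<Sum>i\<in>UNIV. \<bar>u $ i - v $ i\<bar>)"
      using pos_dist_le_l1[of u v] pos_dist_le_l1[of v u] by linarith
  qed
qed

text \<open>The extension step for arbitrary data points in the cube. No grid structure is involved:
  compatibility of the values is expressed by \<open>lip\<close> alone.\<close>

lemma quasi_copula_extension:
  fixes p :: "'i \<Rightarrow> real ^ 'n" and q :: "'i \<Rightarrow> real"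
  assumes ne: "S \<noteq> {}"
    and nonneg: "\<And>I. I \<in> S \<Longrightarrow> 0 \<le> q I"
    and lip: "\<And>I J. I \<in> S \<Longrightarrow> J \<in> S \<Longrightarrow> q J \<le> q I + pos_dist (p J) (p I)"
    and cube: "\<And>I. I \<in> S \<Longrightarrow> p I \<in> unit_cube"
    and bounds: "\<And>I. I \<in> S \<Longrightarrow> G (p I) \<le> q I \<and> q I \<le> H (p I)"
  shows "\<exists>Q. quasi_copula Q \<and> (\<forall>I\<in>S. Q (p I) = q I)"
proof -
  \<comment> \<open>The minimum with \<open>H\<close> is taken inside the infimum, so that every
    bound on \<open>Q\<close> can be checked for one \<open>f I\<close> at a time.\<close>
  define f where "f I u = min (H u) (q I + pos_dist u (p I))" for I u
  define Q where "Q u = (INF I\<in>S. f I u)" for u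
  have f_ge: "0 \<le> f I u" if "I \<in> S" "u \<in> unit_cube" for I u
    using nonneg[OF that(1)] that(2) pos_dist_nonneg[of u "p I"]
    by (simp add: f_def le_H_iff unit_cube_def)
  have bdd: "bdd_below ((\<lambda>I. f I u) ` S)" if "u \<in> unit_cube" for u
    using f_ge[OF _ that] by (intro bdd_belowI2)
  have Q_le: "Q u \<le> f I u" if "I \<in> S" "u \<in> unit_cube" for I u
    unfolding Q_def using bdd that by (intro cINF_lower)
  have Q_ge: "c \<le> Q u" if "\<And>I. I \<in> S \<Longrightarrow> c \<le> f I u" for c u
    unfolding Q_def using ne that by (intro cINF_greatest)
  have Q_le_component: "Q u \<le> u $ i" if "u \<in> unit_cube" for u i
  proof -
    obtain I where "I \<in> S" using ne by blast
    then have "Q u \<le> H u" using Q_le[OF _ that] by (fastforce simp: f_def)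
    then show ?thesis using H_le order_trans by blast
  qed
  have Q_nonneg: "0 \<le> Q u" if "u \<in> unit_cube" for u
    using f_ge that by (intro Q_ge)
  have range: "Q \<in> unit_cube \<rightarrow> {0..1}"
  proof
    fix u :: "real ^ 'n"
    assume u: "u \<in> unit_cube"
    have "u $ i \<le> 1" for i using u by (simp add: unit_cube_def)
    then show "Q u \<in> {0..1}"
      using Q_nonneg[OF u] Q_le_component[OF u] by (meson atLeastAtMost_iff order_trans)
  qed
  have "Q u \<le> Q v + pos_dist u v" if u: "u \<in> unit_cube" and v: "v \<in> unit_cube" for u v
  proof -
    \<comment> \<open>Both arguments of the minimum in \<open>f I\<close> grow by at most
      \<open>pos_dist u v\<close> from v to u: the first by the bound on \<open>H\<close>, the
      second by the triangle inequality.\<close>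
    have "Q u - pos_dist u v \<le> f I v" if "I \<in> S" for I
      using Q_le[OF that u] H_le_pos_dist[of u v] pos_dist_triangle[of u "p I" v]
      unfolding f_def by linarith
    then have "Q u - pos_dist u v \<le> Q v" by (intro Q_ge)
    then show ?thesis by simp
  qed
  note mono_lip = monotonicity_lipschitz_if_pos_dist[OF this]
  have "boundary_condition Q"
    unfolding boundary_condition_def
  proof (intro conjI ballI impI allI)
    fix u :: "real ^ 'n"
    assume "u \<in> unit_cube" "\<exists>i. u $ i = 0"
    then show "Q u = 0" using Q_nonneg[of u] Q_le_component[of u] by (metis order_antisym)
  next
    fix i :: 'n and t :: real
    assume t: "t \<in> {0..1}"
    let ?u = "vec_upd (\<chi> k. 1) i t"
    have u_cube: "?u \<in> unit_cube"
      using t by (intro vec_upd_in_unit_cube) (simp_all add: unit_cube_def)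
    \<comment> \<open>All coordinates but the i-th equal 1, so their sum is t + (d - 1) and
      \<open>G\<close> takes the value t.\<close>
    have "(\<Sum>k\<in>UNIV. ?u $ k) = t + (\<Sum>k\<in>UNIV - {i}. ?u $ k)"
      by (subst sum.remove[of UNIV i]) (simp_all add: vec_upd_nth)
    also have "(\<Sum>k\<in>UNIV - {i}. ?u $ k) = (\<Sum>k\<in>UNIV - {i}. 1)"
      by (intro sum.cong) (simp_all add: vec_upd_nth)
    also have "\<dots> = real CARD('n) - 1"
      by (simp add: card_Diff_singleton of_nat_diff Suc_leI)
    finally have G: "G ?u = t" by (simp add: G_def)
    have "t \<le> H ?u" using t by (simp add: le_H_iff vec_upd_nth)
    \<comment> \<open>The chain is t = \<open>G ?u\<close> \<le> \<open>G (p I)\<close> +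
      \<open>pos_dist ?u (p I)\<close>, followed by \<open>G (p I)\<close> \<le>
      \<open>q I\<close>.\<close>
    moreover have "t \<le> q I + pos_dist ?u (p I)" if "I \<in> S" for I
      using bounds[OF that] G_le_pos_dist[of ?u "p I"] G by linarith
    ultimately have "t \<le> Q ?u" by (intro Q_ge) (simp add: f_def)
    moreover have "Q ?u \<le> t"
      using Q_le_component[OF u_cube, of i] by (simp add: vec_upd_nth)
    ultimately show "Q ?u = t" by simp
  qed
  moreover have "Q (p J) = q J" if J: "J \<in> S" for J
  proof (rule order_antisym)
    \<comment> \<open>The competitor with index J has distance 0 and already gives
      \<open>q J\<close>; by \<open>lip\<close> and the bound by \<open>H\<close>, no other
      competitor falls below it.\<close>
    show "Q (p J) \<le> q J" using Q_le[OF J cube[OF J]] by (simp add: f_def)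
    show "q J \<le> Q (p J)" using bounds[OF J] lip[OF _ J] by (intro Q_ge) (simp add: f_def)
  qed
  ultimately show ?thesis using range mono_lip unfolding quasi_copula_def by blast
qed

lemma vec_upd_in_multi_indices:
  "I \<in> multi_indices \<Longrightarrow> t \<in> {0, 1, 2} \<Longrightarrow> vec_upd I l t \<in> multi_indices"
  by (auto simp: multi_indices_def vec_upd_nth)

lemma adjacent_vec_upd: "adjacent l (vec_upd I l s) (vec_upd I l (s + 1))"
  by (simp add: adjacent_def vec_eq_iff vec_upd_nth axis_def)

lemma vec_upd_triv: "vec_upd I l (I $ l) = I"
  by (simp add: vec_eq_iff vec_upd_nth)

text \<open>The hypotheses on neighbours yield \<open>lip\<close> for all pairs: move from I to J
  one coordinate at a time. A rise costs at most the increment of that coordinate, and a descent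
  costs nothing since q is increasing.\<close>

lemma grid_increment_le_pos_dist:
  fixes a b :: "real ^ 'n" and q :: "int ^ 'n \<Rightarrow> real"
  assumes ab: "\<And>l. a $ l \<le> b $ l" and b1: "\<And>l. b $ l \<le> 1"
    and step1: "\<And>l I J. \<lbrakk>I \<in> multi_indices; J \<in> multi_indices; adjacent l I J; J $ l = 1\<rbrakk>
           \<Longrightarrow> 0 \<le> q J - q I \<and> q J - q I \<le> b $ l - a $ l"
    and step2: "\<And>l I J. \<lbrakk>I \<in> multi_indices; J \<in> multi_indices; adjacent l I J; J $ l = 2\<rbrakk>
           \<Longrightarrow> 0 \<le> q J - q I \<and> q J - q I \<le> 1 - b $ l"
    and I: "I \<in> multi_indices" and J: "J \<in> multi_indices"
  shows "q J \<le> q I + pos_dist (grid_point a b J) (grid_point a b I)"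
proof -
  let ?x = "grid_point a b"
  have single: "q (vec_upd K l t) \<le> q K + max 0 (?x (vec_upd K l t) $ l - ?x K $ l)"
    if K: "K \<in> multi_indices" and t: "t \<in> {0, 1, 2}" for K l t
  proof -
    \<comment> \<open>The values of q on the grid line through K in direction l; adding its two unit
      steps covers a jump between 0 and 2.\<close>
    define r where "r s = q (vec_upd K l s)" for s
    have "0 \<le> r 1 - r 0 \<and> r 1 - r 0 \<le> b $ l - a $ l"
      unfolding r_def using K adjacent_vec_upd[of l K 0]
      by (intro step1) (auto simp: vec_upd_in_multi_indices vec_upd_nth)
    moreover have "0 \<le> r 2 - r 1 \<and> r 2 - r 1 \<le> 1 - b $ l"
      unfolding r_def using K adjacent_vec_upd[of l K 1]
      by (intro step2) (auto simp: vec_upd_in_multi_indices vec_upd_nth)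
    moreover have "q K = r (K $ l)" by (simp add: r_def vec_upd_triv)
    moreover have "K $ l \<in> {0, 1, 2}" using K unfolding multi_indices_def by blast
    ultimately have "r t \<le> q K + max 0 (?x (vec_upd K l t) $ l - ?x K $ l)"
      using t ab[of l] b1[of l] by (auto simp: grid_point_def vec_upd_nth)
    then show ?thesis by (simp add: r_def)
  qed
  \<comment> \<open>A hybrid index, already moved to J on A and still equal to I elsewhere:
    \<open>K {}\<close> is I and \<open>K UNIV\<close> is J.\<close>
  define K where "K A = (\<chi> k. if k \<in> A then J $ k else I $ k)" for A
  have K_in: "K A \<in> multi_indices" for A
    using I J by (simp add: K_def multi_indices_def)
  have "q (K A) \<le> q I + (\<Sum>k\<in>A. max 0 (?x J $ k - ?x I $ k))" for A
  proof (induction A rule: finite_induct[OF finite])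
    case 1
    then show ?case by (simp add: K_def vec_lambda_eta)
  next
    case (2 l A)
    have "K (insert l A) = vec_upd (K A) l (J $ l)"
      by (auto simp: K_def vec_upd_def vec_eq_iff)
    \<comment> \<open>Since l is not in A, the l-th coordinate has not been moved before this
      step.\<close>
    moreover have "?x (vec_upd (K A) l (J $ l)) $ l = ?x J $ l" "?x (K A) $ l = ?x I $ l"
      using 2 by (simp_all add: grid_point_def K_def vec_upd_nth)
    moreover have "J $ l \<in> {0, 1, 2}" using J unfolding multi_indices_def by blast
    ultimately have "q (K (insert l A)) \<le> q (K A) + max 0 (?x J $ l - ?x I $ l)"
      using single[OF K_in, of "J $ l" A l] by simp
    then show ?case using 2 by simp
  qed
  from this[of UNIV] show ?thesis
    by (simp add: K_def pos_dist_def vec_lambda_eta)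
qed

theorem theorem2p2:
  fixes a b :: "real ^ 'n" and q :: "int ^ 'n \<Rightarrow> real"
  assumes "CARD('n) \<ge> 2"
    and "\<And>i. a $ i \<in> {0..1}"
    and "\<And>i. b $ i \<in> {0..1}"
    and "\<And>I. I \<in> multi_indices \<Longrightarrow> q I \<in> {0..1}"
    and "\<And>l. a $ l < b $ l"
    and "\<And>l I J. \<lbrakk>I \<in> multi_indices; J \<in> multi_indices; adjacent l I J; J $ l = 1\<rbrakk>
           \<Longrightarrow> 0 \<le> q J - q I \<and> q J - q I \<le> b $ l - a $ l"
    and "\<And>l I J. \<lbrakk>I \<in> multi_indices; J \<in> multi_indices; adjacent l I J; J $ l = 2\<rbrakk>
           \<Longrightarrow> 0 \<le> q J - q I \<and> q J - q I \<le> 1 - b $ l"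
    and "\<And>I. I \<in> multi_indices \<Longrightarrow>
           G (grid_point a b I) \<le> q I \<and> q I \<le> H (grid_point a b I)"
  shows "\<exists>Q :: real ^ 'n \<Rightarrow> real. quasi_copula Q \<and>
           (\<forall>I \<in> multi_indices. Q (grid_point a b I) = q I)"
\<comment> \<open>The data points are the grid points, indexed by \<open>multi_indices\<close>; the
  compatibility \<open>lip\<close> comes from the path argument.\<close>
proof (rule quasi_copula_extension)
  show "(multi_indices :: (int ^ 'n) set) \<noteq> {}"
    by (auto simp: multi_indices_def intro: exI[of _ "\<chi> k. 0"])
next
  fix I :: "int ^ 'n"
  assume I: "I \<in> multi_indices"
  show "0 \<le> q I" using assms(4)[OF I] by simp
  show "grid_point a b I \<in> unit_cube"
    using assms(2,3) by (simp add: unit_cube_def grid_point_def)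
  show "G (grid_point a b I) \<le> q I \<and> q I \<le> H (grid_point a b I)"
    using assms(8)[OF I] .
next
  fix I J :: "int ^ 'n"
  assume IJ: "I \<in> multi_indices" "J \<in> multi_indices"
  have "a $ l \<le> b $ l" "b $ l \<le> 1" for l
    using assms(3)[of l] assms(5)[of l] by simp_all
  then show "q J \<le> q I + pos_dist (grid_point a b J) (grid_point a b I)"
    using assms(6,7) IJ by (rule grid_increment_le_pos_dist)
qed

end
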